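(* Let $F:[0,\infty)\times\mathbb{R}^d\to\mathbb{R}^d$ be continuous in $t$, locally Lipschitz in $y$, with $F(t,0)\equiv0$, and let $F$ be uniformly Lipschitz in $y$ in a neighbourhood of $0$: there are $L>0$, $r_0>0$ such that $\|F(t,y_1)-F(t,y_2)\|\le L\|y_1-y_2\|$ for all $t\ge0$ and all $\|y_1\|<r_0$, $\|y_2\|<r_0$. Assume that the zero solution of $\dot y(t)=F(t,y)$, $y(0)=0$, is exponentially stable in the sense that there are constants $r>0$, $c>0$, $K>0$ such that $$\|y(t;t_0,y_0)\|\le K e^{-c(t-t_0)}\|y_0\|$$ for all $\|y_0\|<r$, $t_0\ge0$, $t\ge t_0$. Then the $E(t)$ of the zero solution is bounded above by a constant for all $t\ge0$.
   Context: Norms are Euclidean. "Locally Lipschitz in $y$" means that each point $(t,y)$ has a neighbourhood on which $F$ is Lipschitz in $y$ with a constant independent of $t$. Let $y(t;s,\eta)$ denote the solution of $\dot y=F(t,y)$ with $y(s)=\eta$. Definition of $E$: let $\alpha:[0,\infty)\to[0,\infty)$ be any continuous strictly increasing function with $\alpha(0)=0$. For $h>0$ the family $\tilde Y_\alpha(h)$ of approximations to the zero solution consists of all functions $\tilde y(\cdot;h)$ obtained from sequences $v_1,v_2,\dots\in\mathbb{R}^d$ with $\|v_n\|\le 1$ by $\tilde y(0;h)=0$, $\tilde y(nh;h)=y(nh;(n-1)h,\tilde y((n-1)h;h))+h\alpha(h)v_n$ for $n\ge1$, and $\tilde y(t;h)=y(t;(n-1)h,\tilde y((n-1)h;h))$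 for $(n-1)h\le t<nh$. For every $T>0$ all these approximations exist on $[0,T]$ once $h$ is small enough. Define $e_\alpha(t;h)=\sup_{\tilde y\in\tilde Y_\alpha(h)}\|\tilde y(t;h)\|$ and $E(t)=E_\alpha(t)=\limsup_{h\to0^+} e_\alpha(t;h)/\alpha(h)$; this value does not depend on the choice of $\alpha$. *)

theory Defs
  imports "HOL-Analysis.Analysis"
begin

text \<open>
  The solution y(t; s, eta) is partial, since solutions may blow up in finite time. It is therefore
  rendered by its graph: \<open>ivp_value F t s \<eta> x\<close> says that y(t; s, eta) exists and equals x. When \<open>F\<close> is
  continuous in \<open>t\<close> and locally Lipschitz in \<open>y\<close>, there is at most one such \<open>x\<close>.
\<close>

definition solves_ivp ::
  "(real \<Rightarrow> 'a::real_normed_vector \<Rightarrow> 'a) \<Rightarrow> real \<Rightarrow> 'a \<Rightarrow> real \<Rightarrow> (real \<Rightarrow> 'a) \<Rightarrow> bool" where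
  "solves_ivp F s \<eta> t y \<longleftrightarrow>
     y s = \<eta> \<and> (\<forall>\<tau>\<in>{s..t}. (y has_vector_derivative F \<tau> (y \<tau>)) (at \<tau> within {s..t}))"

definition ivp_value ::
  "(real \<Rightarrow> 'a::real_normed_vector \<Rightarrow> 'a) \<Rightarrow> real \<Rightarrow> real \<Rightarrow> 'a \<Rightarrow> 'a \<Rightarrow> bool" where
  "ivp_value F t s \<eta> x \<longleftrightarrow> s \<le> t \<and> (\<exists>y. solves_ivp F s \<eta> t y \<and> y t = x)"

definition exponentially_stable :: "(real \<Rightarrow> 'a::real_normed_vector \<Rightarrow> 'a) \<Rightarrow> bool" where
  "exponentially_stable F \<longleftrightarrow>
     (\<exists>r>0. \<exists>c>0. \<exists>K>0. \<forall>y0 t0 t. norm y0 < r \<longrightarrow> 0 \<le> t0 \<longrightarrow> t0 \<le> t \<longrightarrow>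
        (\<exists>x. ivp_value F t t0 y0 x \<and> norm x \<le> K * exp (- c * (t - t0)) * norm y0))"

definition gauge_fun :: "(real \<Rightarrow> real) \<Rightarrow> bool" where
  "gauge_fun \<alpha> \<longleftrightarrow> continuous_on {0..} \<alpha> \<and> strict_mono_on {0..} \<alpha> \<and> \<alpha> 0 = 0"

definition perturbations :: "(nat \<Rightarrow> 'a::real_normed_vector) set" where
  "perturbations = {v. \<forall>n\<ge>1. norm (v n) \<le> 1}"

text \<open>
  \<open>approximation F \<alpha> h v T y\<close>: the approximation generated by \<open>v\<close> with step \<open>h\<close> exists on \<open>[0, T]\<close> and
  coincides there with \<open>y\<close>; the values of \<open>y\<close> outside \<open>[0, T]\<close> are irrelevant.
\<close>

definition approximation ::
  "(real \<Rightarrow> 'a::real_normed_vector \<Rightarrow> 'a) \<Rightarrow> (real \<Rightarrow> real) \<Rightarrow> real \<Rightarrow> (nat \<Rightarrow> 'a) \<Rightarrow> real \<Rightarrow>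
   (real \<Rightarrow> 'a) \<Rightarrow> bool" where
  "approximation F \<alpha> h v T y \<longleftrightarrow>
     y 0 = 0 \<and>
     (\<forall>n\<ge>1. real n * h \<le> T \<longrightarrow>
        (\<exists>x. ivp_value F (real n * h) (real (n - 1) * h) (y (real (n - 1) * h)) x \<and>
             y (real n * h) = x + (h * \<alpha> h) *\<^sub>R v n)) \<and>
     (\<forall>n\<ge>1. \<forall>t. real (n - 1) * h \<le> t \<longrightarrow> t < real n * h \<longrightarrow> t \<le> T \<longrightarrow>
        ivp_value F t (real (n - 1) * h) (y (real (n - 1) * h)) (y t))"

definition approximations ::
  "(real \<Rightarrow> 'a::real_normed_vector \<Rightarrow> 'a) \<Rightarrow> (real \<Rightarrow> real) \<Rightarrow> real \<Rightarrow> real \<Rightarrow> (real \<Rightarrow> 'a) set" where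
  "approximations F \<alpha> h T = {y. \<exists>v\<in>perturbations. approximation F \<alpha> h v T y}"

text \<open>
  If some approximation fails to exist on \<open>[0, t]\<close>, its error at \<open>t\<close> counts as infinite. For fixed \<open>t\<close>
  this does not happen once \<open>h\<close> is small, so the upper limit below is unaffected.
\<close>

definition max_error ::
  "(real \<Rightarrow> 'a::real_normed_vector \<Rightarrow> 'a) \<Rightarrow> (real \<Rightarrow> real) \<Rightarrow> real \<Rightarrow> real \<Rightarrow> ereal" where
  "max_error F \<alpha> t h =
     (if \<forall>v\<in>perturbations. \<exists>y. approximation F \<alpha> h v t y
      then SUP y\<in>approximations F \<alpha> h t. ereal (norm (y t)) else \<infinity>)"

definition E_fun ::
  "(real \<Rightarrow> 'a::real_normed_vector \<Rightarrow> 'a) \<Rightarrow> (real \<Rightarrow> real) \<Rightarrow> real \<Rightarrow> ereal" where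
  "E_fun F \<alpha> t = Limsup (at_right 0) (\<lambda>h. max_error F \<alpha> t h / ereal (\<alpha> h))"

end

theory Submission
  imports Defs
begin

text \<open>
  Fix a time \<open>H\<close> with \<open>K exp(-c H) \<le> 1/2\<close>. Over a window of length about \<open>H\<close>, Gronwall's inequality
  bounds the distance between a perturbed orbit and the exact solution from the same starting point by
  \<open>M \<alpha>(h)\<close>, where \<open>M\<close> depends only on \<open>H\<close> and the Lipschitz constant, and over such a window the
  exact solution decays to at most half its initial norm. Hence the norm on the grid never exceeds \<open>2 M \<alpha>(h)\<close>,
  the fixed point of \<open>x \<mapsto> x/2 + M \<alpha>(h)\<close>, which for small \<open>h\<close> keeps the orbit where the stability and
  Lipschitz estimates hold; between grid points at most another factor \<open>K\<close> is lost.
\<close>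

section \<open>Gronwall's inequality and uniqueness of solutions\<close>

text \<open>The norm is not differentiable at 0, so the argument runs on its square: by
  Cauchy-Schwarz the derivative of \<open>u \<tau> \<bullet> u \<tau>\<close> is at most
  \<open>2 * L\<close> times the square itself, and the weight
  \<open>exp (- (2 * L) * \<tau>)\<close> makes it nonincreasing.\<close>

lemma gronwall_norm:
  fixes u u' :: "real \<Rightarrow> 'a::real_inner"
  assumes "s \<le> t"
    and der: "\<And>\<tau>. \<tau> \<in> {s..t} \<Longrightarrow> (u has_vector_derivative u' \<tau>) (at \<tau> within {s..t})"
    and bound: "\<And>\<tau>. \<tau> \<in> {s..t} \<Longrightarrow> norm (u' \<tau>) \<le> L * norm (u \<tau>)"
  shows "norm (u t) \<le> exp (L * (t - s)) * norm (u s)"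
proof -
  define g where "g = (\<lambda>\<tau>. exp (- (2 * L) * \<tau>) * (u \<tau> \<bullet> u \<tau>))"
  have "continuous_on {s..t} u"
    using der has_vector_derivative_continuous continuous_on_eq_continuous_within by blast
  then have cont: "continuous_on {s..t} g"
    unfolding g_def by (intro continuous_intros)
  have "g s \<ge> g t"
  proof (rule DERIV_nonpos_imp_decreasing_open[OF \<open>s \<le> t\<close> _ cont])
    fix x assume x: "s < x" "x < t"
    have "(u has_derivative (\<lambda>h. h *\<^sub>R u' x)) (at x)"
      using der[of x] x by (simp add: has_vector_derivative_def at_within_Icc_at)
    then have "((\<lambda>\<tau>. u \<tau> \<bullet> u \<tau>) has_derivative (\<lambda>h. u x \<bullet> (h *\<^sub>R u' x) + (h *\<^sub>R u' x) \<bullet> u x)) (at x)"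
      by (intro has_derivative_inner)
    then have inner: "((\<lambda>\<tau>. u \<tau> \<bullet> u \<tau>) has_real_derivative (2 * (u x \<bullet> u' x))) (at x)"
      unfolding has_field_derivative_def
      by (rule has_derivative_eq_rhs) (auto simp: inner_commute)
    have "(g has_real_derivative (exp (- (2 * L) * x) * (2 * (u x \<bullet> u' x) - 2 * L * (u x \<bullet> u x)))) (at x)"
      unfolding g_def by (rule derivative_eq_intros inner refl | simp add: algebra_simps)+
    moreover have "u x \<bullet> u' x \<le> L * (u x \<bullet> u x)"
    proof -
      have "u x \<bullet> u' x \<le> norm (u x) * norm (u' x)"
        by (rule norm_cauchy_schwarz)
      also have "\<dots> \<le> norm (u x) * (L * norm (u x))"
        using bound[of x] x by (intro mult_left_mono) auto
      finally show ?thesis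
        by (simp add: dot_square_norm power2_eq_square mult_ac)
    qed
    ultimately show "\<exists>y. (g has_real_derivative y) (at x) \<and> y \<le> 0"
      by (auto intro!: exI mult_nonneg_nonpos)
  qed
  then have "u t \<bullet> u t \<le> exp (2 * L * (t - s)) * (u s \<bullet> u s)"
    by (simp add: g_def exp_minus exp_diff field_simps)
  then have "(norm (u t))\<^sup>2 \<le> (exp (L * (t - s)) * norm (u s))\<^sup>2"
    by (simp add: dot_square_norm power_mult_distrib exp_double[symmetric] mult.assoc)
  then show ?thesis
    by (rule power2_le_imp_le) simp
qed

lemma solves_ivp_subinterval:
  assumes "solves_ivp F s \<eta> t y" "s \<le> s'" "t' \<le> t"
  shows "solves_ivp F s' (y s') t' y"
  using assms unfolding solves_ivp_def
  by (auto intro!: has_vector_derivative_within_subset[of _ _ _ "{s..t}" "{s'..t'}"])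

lemma solves_ivp_continuous_on:
  assumes "solves_ivp F s \<eta> t y"
  shows "continuous_on {s..t} y"
  using assms has_vector_derivative_continuous continuous_on_eq_continuous_within
  unfolding solves_ivp_def by blast

text \<open>The Lipschitz bound is asked for along the two trajectories, so it can come from
  compactness, as for uniqueness, or from the uniform constant near 0.\<close>

lemma solves_ivp_norm_diff:
  fixes F :: "real \<Rightarrow> 'a::real_inner \<Rightarrow> 'a"
  assumes y: "solves_ivp F s \<eta> t y" and z: "solves_ivp F s \<zeta> t z" and "s \<le> t"
    and lip: "\<And>\<tau>. \<tau> \<in> {s..t} \<Longrightarrow> norm (F \<tau> (y \<tau>) - F \<tau> (z \<tau>)) \<le> L * norm (y \<tau> - z \<tau>)"
  shows "norm (y t - z t) \<le> exp (L * (t - s)) * norm (\<eta> - \<zeta>)"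
proof -
  have "norm (y t - z t) \<le> exp (L * (t - s)) * norm (y s - z s)"
    using y z lip
    by (intro gronwall_norm[where u = "\<lambda>\<tau>. y \<tau> - z \<tau>" and u' = "\<lambda>\<tau>. F \<tau> (y \<tau>) - F \<tau> (z \<tau>)"] \<open>s \<le> t\<close>)
      (auto simp: solves_ivp_def intro!: has_vector_derivative_diff)
  then show ?thesis
    using y z by (simp add: solves_ivp_def)
qed

lemma solves_ivp_unique:
  fixes F :: "real \<Rightarrow> 'a::real_inner \<Rightarrow> 'a"
  assumes cont_t: "\<And>y. continuous_on {0..} (\<lambda>t. F t y)"
    and loc_lip: "local_lipschitz {0..} UNIV F"
    and y: "solves_ivp F s \<eta> t y" and z: "solves_ivp F s \<eta> t z" and st: "0 \<le> s" "s \<le> t"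
  shows "y t = z t"
proof -
  \<comment> \<open>Both trajectories are compact, so local Lipschitz continuity yields a single
    constant on their union.\<close>
  define X where "X = y ` {s..t} \<union> z ` {s..t}"
  have "compact X"
    unfolding X_def
    using solves_ivp_continuous_on[OF y] solves_ivp_continuous_on[OF z]
    by (intro compact_Un compact_continuous_image) auto
  moreover have "local_lipschitz {s..t} X F"
    using local_lipschitz_subset[OF loc_lip] st by auto
  moreover have "continuous_on {s..t} (\<lambda>t. F t x)" for x
    using continuous_on_subset[OF cont_t] st by auto
  ultimately obtain L where L: "\<And>\<tau>. \<tau> \<in> {s..t} \<Longrightarrow> L-lipschitz_on X (F \<tau>)"
    using local_lipschitz_compact_implies_lipschitz[of "{s..t}" X F] by blast
  have "norm (y t - z t) \<le> exp (L * (t - s)) * norm (\<eta> - \<eta>)"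
  proof (rule solves_ivp_norm_diff[OF y z \<open>s \<le> t\<close>])
    fix \<tau> assume \<tau>: "\<tau> \<in> {s..t}"
    then show "norm (F \<tau> (y \<tau>) - F \<tau> (z \<tau>)) \<le> L * norm (y \<tau> - z \<tau>)"
      using lipschitz_onD[OF L[OF \<tau>], of "y \<tau>" "z \<tau>"] by (auto simp: X_def dist_norm)
  qed
  then show ?thesis by simp
qed

lemma ivp_value_unique:
  fixes F :: "real \<Rightarrow> 'a::real_inner \<Rightarrow> 'a"
  assumes "\<And>y. continuous_on {0..} (\<lambda>t. F t y)" "local_lipschitz {0..} UNIV F"
    and "ivp_value F t s \<eta> x" "ivp_value F t s \<eta> x'" "0 \<le> s"
  shows "x = x'"
  using assms(3-5) solves_ivp_unique[OF assms(1,2)] unfolding ivp_value_def by blast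

section \<open>Decay of solutions that start near 0\<close>

text \<open>One radius \<open>r\<close> serves the Lipschitz bound and the decay alike;
  \<open>1 \<le> K\<close> ensures that a bound \<open>K * B < r\<close> also gives
  \<open>B < r\<close> for nonnegative \<open>B\<close>.\<close>

locale stable_ivp =
  fixes F :: "real \<Rightarrow> 'a::real_inner \<Rightarrow> 'a" and L r c K :: real
  assumes cont_t: "\<And>y. continuous_on {0..} (\<lambda>t. F t y)"
    and loc_lip: "local_lipschitz {0..} UNIV F"
    and lip: "\<And>t y z. 0 \<le> t \<Longrightarrow> norm y < r \<Longrightarrow> norm z < r \<Longrightarrow>
                norm (F t y - F t z) \<le> L * norm (y - z)"
    and decay: "\<And>y s t. norm y < r \<Longrightarrow> 0 \<le> s \<Longrightarrow> s \<le> t \<Longrightarrow>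
                  \<exists>x. ivp_value F t s y x \<and> norm x \<le> K * exp (- c * (t - s)) * norm y"
    and L_pos: "0 < L" and r_pos: "0 < r" and c_pos: "0 < c" and K_ge_1: "1 \<le> K"
begin

lemma solution_exists:
  assumes "norm \<eta> < r" "0 \<le> s" "s \<le> t"
  obtains y where "solves_ivp F s \<eta> t y"
  using decay[OF assms] unfolding ivp_value_def by blast

text \<open>\<open>decay\<close> provides some value with the estimate; uniqueness carries it over
  to any given value.\<close>

lemma ivp_value_decay:
  assumes "norm \<eta> < r" "0 \<le> s" "ivp_value F t s \<eta> x"
  shows "norm x \<le> K * exp (- c * (t - s)) * norm \<eta>"
proof -
  have "s \<le> t"
    using assms(3) by (simp add: ivp_value_def)
  then obtain x' where "ivp_value F t s \<eta> x'" "norm x' \<le> K * exp (- c * (t - s)) * norm \<eta>"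
    using decay[OF assms(1,2)] by blast
  then show ?thesis
    using ivp_value_unique[OF cont_t loc_lip assms(3) _ assms(2)] by blast
qed

lemma solution_decay:
  assumes "norm \<eta> < r" "0 \<le> s" "solves_ivp F s \<eta> t y" "\<tau> \<in> {s..t}"
  shows "norm (y \<tau>) \<le> K * exp (- c * (\<tau> - s)) * norm \<eta>"
proof (rule ivp_value_decay[OF assms(1,2)])
  have "y s = \<eta>"
    using assms(3) by (simp add: solves_ivp_def)
  then show "ivp_value F \<tau> s \<eta> (y \<tau>)"
    using assms(4) solves_ivp_subinterval[OF assms(3), of s \<tau>] by (auto simp: ivp_value_def)
qed

lemma decay_factor_le:
  assumes "s \<le> t"
  shows "K * exp (- c * (t - s)) * norm \<eta> \<le> K * norm \<eta>"
proof -
  have "exp (- c * (t - s)) \<le> 1"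
    using c_pos assms by (simp add: mult_nonneg_nonneg)
  then have "K * exp (- c * (t - s)) \<le> K * 1"
    using K_ge_1 by (intro mult_left_mono) auto
  then show ?thesis
    by (intro mult_right_mono) auto
qed

lemma solution_bounded:
  assumes "norm \<eta> < r" "0 \<le> s" "solves_ivp F s \<eta> t y" "\<tau> \<in> {s..t}"
  shows "norm (y \<tau>) \<le> K * norm \<eta>"
  using solution_decay[OF assms] decay_factor_le[of s \<tau> \<eta>] assms(4) by auto

lemma ivp_value_bounded:
  assumes "norm \<eta> < r" "0 \<le> s" "ivp_value F t s \<eta> x"
  shows "norm x \<le> K * norm \<eta>"
  using ivp_value_decay[OF assms] decay_factor_le[of s t \<eta>] assms(3) by (auto simp: ivp_value_def)

section \<open>Error growth over one window\<close>

text \<open>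
  The steps are constrained only inside the ball of radius \<open>r\<close>: outside it solutions may fail to exist,
  and that the orbit stays inside is only known a posteriori.
\<close>

definition perturbed_orbit :: "real \<Rightarrow> real \<Rightarrow> real \<Rightarrow> (nat \<Rightarrow> 'a) \<Rightarrow> bool" where
  "perturbed_orbit h a T g \<longleftrightarrow>
     (\<forall>n. real (Suc n) * h \<le> T \<longrightarrow> norm (g n) < r \<longrightarrow>
       (\<exists>x. ivp_value F (real (Suc n) * h) (real n * h) (g n) x \<and> norm (g (Suc n) - x) \<le> h * a))"

text \<open>Compare with the exact solution from \<open>g m\<close>: each step stretches the
  accumulated distance by at most \<open>exp (L * h)\<close>, and the jump adds at most
  \<open>h * a\<close>. The condition \<open>K * B < r\<close> keeps all solutions involved inside
  the ball where the Lipschitz bound holds. Past the start, \<open>B\<close> is assumed for indices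
  before \<open>m + j\<close>, as suits a strong induction.\<close>

lemma window_bound:
  assumes orbit: "perturbed_orbit h a T g" and "0 < h" "0 \<le> a"
    and T: "real (m + j) * h \<le> T"
    and B: "\<And>i. i < j \<Longrightarrow> norm (g (m + i)) \<le> B" and KB: "K * B < r" and "norm (g m) \<le> B"
  shows "norm (g (m + j)) \<le> K * exp (- c * (real j * h)) * norm (g m)
           + real j * h * exp (L * (real j * h)) * a"
proof -
  define s where "s = (\<lambda>i. real (m + i) * h)"
  have "0 \<le> B" using \<open>norm (g m) \<le> B\<close> norm_ge_zero order_trans by blast
  then have "B \<le> K * B" using K_ge_1 by (simp add: mult_le_cancel_right1)
  then have "B < r" using KB by simp
  have s_mono: "s i \<le> s i'" if "i \<le> i'" for i i'
    using that \<open>0 < h\<close> by (auto simp: s_def intro!: mult_right_mono)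
  have s_nn: "0 \<le> s i" for i using \<open>0 < h\<close> by (simp add: s_def)
  have s_diff: "s i - s i' = (real i - real i') * h" for i i'
    by (simp add: s_def algebra_simps)
  have gm: "norm (g m) < r"
    using \<open>norm (g m) \<le> B\<close> \<open>B < r\<close> by simp
  obtain z where z: "solves_ivp F (s 0) (g m) (s j) z"
    using solution_exists[OF gm s_nn[of 0] s_mono[of 0 j]] by auto
  have z_small: "norm (z \<tau>) < r" if "\<tau> \<in> {s 0..s j}" for \<tau>
  proof -
    have "norm (z \<tau>) \<le> K * norm (g m)"
      by (rule solution_bounded[OF gm s_nn z that])
    also have "\<dots> \<le> K * B"
      using \<open>norm (g m) \<le> B\<close> K_ge_1 by (intro mult_left_mono) auto
    finally show ?thesis using KB by simp
  qed
  have "norm (g (m + i) - z (s i)) \<le> real i * h * exp (L * (real i * h)) * a" if "i \<le> j" for i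
    using that
  proof (induction i)
    case 0
    then show ?case using z by (simp add: solves_ivp_def)
  next
    case (Suc i)
    have gi: "norm (g (m + i)) \<le> B" using B Suc.prems by simp
    then have gi_r: "norm (g (m + i)) < r" using \<open>B < r\<close> by simp
    have "real (Suc (m + i)) * h \<le> T"
      using T s_mono[OF Suc.prems] unfolding s_def add_Suc_right by (rule order_trans[rotated])
    then obtain x where x: "ivp_value F (s (Suc i)) (s i) (g (m + i)) x"
      and gx: "norm (g (m + Suc i) - x) \<le> h * a"
      using orbit gi_r unfolding perturbed_orbit_def s_def by (metis add_Suc_right)
    then obtain y where y: "solves_ivp F (s i) (g (m + i)) (s (Suc i)) y" and yx: "y (s (Suc i)) = x"
      by (auto simp: ivp_value_def)
    have z': "solves_ivp F (s i) (z (s i)) (s (Suc i)) z"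
      using solves_ivp_subinterval[OF z s_mono s_mono] Suc.prems by simp
    have "norm (y (s (Suc i)) - z (s (Suc i))) \<le> exp (L * (s (Suc i) - s i)) * norm (g (m + i) - z (s i))"
    proof (rule solves_ivp_norm_diff[OF y z' s_mono])
      fix \<tau> assume \<tau>: "\<tau> \<in> {s i..s (Suc i)}"
      then have \<tau>0: "\<tau> \<in> {s 0..s j}"
        using s_mono[of 0 i] s_mono[OF Suc.prems] by auto
      have "norm (y \<tau>) \<le> K * norm (g (m + i))"
        by (rule solution_bounded[OF gi_r s_nn y \<tau>])
      also have "\<dots> \<le> K * B"
        using gi K_ge_1 by (intro mult_left_mono) auto
      finally have "norm (y \<tau>) < r" using KB by simp
      then show "norm (F \<tau> (y \<tau>) - F \<tau> (z \<tau>)) \<le> L * norm (y \<tau> - z \<tau>)"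
        using z_small[OF \<tau>0] \<tau> s_nn[of i] by (intro lip) auto
    qed simp
    then have "norm (x - z (s (Suc i))) \<le> exp (L * h) * norm (g (m + i) - z (s i))"
      by (simp add: yx s_diff)
    also have "\<dots> \<le> exp (L * h) * (real i * h * exp (L * (real i * h)) * a)"
      using Suc by (intro mult_left_mono) auto
    also have "\<dots> = real i * h * exp (L * (real (Suc i) * h)) * a"
      by (simp add: algebra_simps exp_add)
    finally have 1: "norm (x - z (s (Suc i))) \<le> real i * h * exp (L * (real (Suc i) * h)) * a" .
    \<comment> \<open>The fresh jump is not stretched yet; inflating it by the same exponential
      merges it with the \<open>i\<close> earlier terms into \<open>Suc i\<close> equal
      ones.\<close>
    have "1 \<le> exp (L * (real (Suc i) * h))"
      using L_pos \<open>0 < h\<close> by simp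
    then have "(h * a) * 1 \<le> (h * a) * exp (L * (real (Suc i) * h))"
      using \<open>0 < h\<close> \<open>0 \<le> a\<close> by (intro mult_left_mono) auto
    then have "norm (g (m + Suc i) - x) \<le> h * exp (L * (real (Suc i) * h)) * a"
      using gx by (simp add: mult_ac)
    moreover have "norm (g (m + Suc i) - z (s (Suc i))) \<le> norm (g (m + Suc i) - x) + norm (x - z (s (Suc i)))"
      using norm_triangle_ineq[of "g (m + Suc i) - x" "x - z (s (Suc i))"] by simp
    ultimately show ?case
      using 1 by (simp add: algebra_simps)
  qed
  from this[of j] have "norm (g (m + j) - z (s j)) \<le> real j * h * exp (L * (real j * h)) * a" by simp
  moreover have "norm (z (s j)) \<le> K * exp (- c * (real j * h)) * norm (g m)"
    using solution_decay[OF gm s_nn z, of "s j"] s_mono[of 0 j] by (simp add: s_diff)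
  moreover have "norm (g (m + j)) \<le> norm (g (m + j) - z (s j)) + norm (z (s j))"
    using norm_triangle_ineq[of "g (m + j) - z (s j)" "z (s j)"] by simp
  ultimately show ?thesis by linarith
qed

section \<open>Uniform bound on the grid\<close>

text \<open>The time at which \<open>K * exp (- c * \<tau>)\<close> equals 1/2.\<close>

definition halving_time :: real where
  "halving_time = ln (2 * K) / c"

text \<open>The \<open>M\<close> of the overview. A window is a whole number of steps and may
  overshoot \<open>halving_time\<close> by up to one step; the summand 1 absorbs this when
  \<open>h \<le> 1\<close>.\<close>

definition window_error :: real where
  "window_error = (halving_time + 1) * exp (L * (halving_time + 1))"

lemma halving_time_pos: "0 < halving_time"
  using K_ge_1 c_pos by (simp add: halving_time_def)

lemma decay_halving:
  assumes "halving_time \<le> \<tau>"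
  shows "K * exp (- c * \<tau>) \<le> 1 / 2"
proof -
  have "ln (2 * K) \<le> c * \<tau>"
    using assms c_pos by (simp add: halving_time_def field_simps)
  then have "exp (- c * \<tau>) \<le> exp (- ln (2 * K))" by simp
  also have "\<dots> = 1 / (2 * K)" using K_ge_1 by (simp add: exp_minus field_simps)
  finally show ?thesis using K_ge_1 by (simp add: field_simps)
qed

text \<open>Strong induction: an index in the first window is compared with the solution from
  \<open>g 0 = 0\<close>, a later one with the solution started one full window earlier.\<close>

lemma orbit_bound:
  assumes orbit: "perturbed_orbit h a T g" and "g 0 = 0" and h: "0 < h" "h \<le> 1" and "0 \<le> a"
    and small: "K * (2 * window_error * a) < r"
    and "real n * h \<le> T"
  shows "norm (g n) \<le> 2 * window_error * a"
  using \<open>real n * h \<le> T\<close>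
proof (induction n rule: less_induct)
  case (less n)
  \<comment> \<open>The fewest steps that cover \<open>halving_time\<close>, so the window length
    lies between \<open>halving_time\<close> and \<open>halving_time + 1\<close> whatever
    \<open>h\<close> is.\<close>
  define N where "N = nat \<lceil>halving_time / h\<rceil>"
  have "halving_time / h \<le> real N"
    unfolding N_def by (rule real_nat_ceiling_ge)
  then have N_ge: "halving_time \<le> real N * h"
    using h by (simp add: field_simps)
  have "real N \<le> halving_time / h + 1"
    using halving_time_pos h by (simp add: N_def ceiling_correct)
  then have "real N * h \<le> (halving_time / h + 1) * h"
    using h by (intro mult_right_mono) auto
  also have "\<dots> \<le> halving_time + 1"
    using h by (simp add: field_simps)
  finally have N_le: "real N * h \<le> halving_time + 1" .
  have "0 < N"
    using N_ge halving_time_pos by (cases N) auto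
  have error: "real j * h * exp (L * (real j * h)) * a \<le> window_error * a" if "j \<le> N" for j
  proof -
    have "real j * h \<le> real N * h"
      using that h by (intro mult_right_mono) auto
    then have "real j * h \<le> halving_time + 1" using N_le by simp
    then show ?thesis
      unfolding window_error_def using h L_pos \<open>0 \<le> a\<close> halving_time_pos
      by (intro mult_right_mono mult_mono) auto
  qed
  have IH: "norm (g i) \<le> 2 * window_error * a" if "i < n" for i
  proof (rule less.IH[OF that])
    have "real i * h \<le> real n * h" using that h by (intro mult_right_mono) auto
    then show "real i * h \<le> T" using less.prems by simp
  qed
  have M_nn: "0 \<le> window_error * a" "0 \<le> 2 * window_error * a"
    using halving_time_pos \<open>0 \<le> a\<close> by (simp_all add: window_error_def)
  show ?case
  proof (cases "n \<le> N")
    case True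
    \<comment> \<open>The window may be too short for halving, but it starts at 0, so the decay term
      vanishes.\<close>
    have "norm (g (0 + n)) \<le> K * exp (- c * (real n * h)) * norm (g 0)
            + real n * h * exp (L * (real n * h)) * a"
      using less.prems IH M_nn \<open>g 0 = 0\<close> \<open>0 \<le> a\<close> h
      by (intro window_bound[OF orbit _ _ _ _ small]) auto
    also have "\<dots> \<le> window_error * a"
      using error[OF True] \<open>g 0 = 0\<close> by simp
    also have "\<dots> \<le> 2 * window_error * a"
      using M_nn by simp
    finally show ?thesis by simp
  next
    case False
    \<comment> \<open>Since \<open>0 < N\<close>, the induction hypothesis covers the start
      \<open>m\<close> and all indices between \<open>m\<close> and \<open>n\<close>.\<close>
    define m where "m = n - N"
    have n: "n = m + N" and "m < n" using False \<open>0 < N\<close> by (auto simp: m_def)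
    have "norm (g (m + N)) \<le> K * exp (- c * (real N * h)) * norm (g m)
            + real N * h * exp (L * (real N * h)) * a"
      using less.prems IH \<open>m < n\<close> n \<open>0 \<le> a\<close> h
      by (intro window_bound[OF orbit _ _ _ _ small]) auto
    also have "\<dots> \<le> 1 / 2 * (2 * window_error * a) + window_error * a"
      using IH[OF \<open>m < n\<close>] decay_halving[OF N_ge] K_ge_1
      by (intro add_mono mult_mono error) auto
    finally show ?thesis by (simp add: n mult_ac)
  qed
qed

section \<open>From the grid to the approximations\<close>

text \<open>Sampled at multiples of \<open>h\<close>, an approximation is a perturbed orbit. From
  the last grid point up to \<open>T\<close> it follows an exact solution, which costs the factor
  \<open>K\<close>.\<close>

lemma approximation_bound:
  assumes approx: "approximation F \<alpha> h v T y" and v: "v \<in> perturbations" and h: "0 < h" "h \<le> 1"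
    and "0 \<le> \<alpha> h" and small: "K * (2 * window_error * \<alpha> h) < r" and "0 \<le> T"
  shows "norm (y T) \<le> K * (2 * window_error * \<alpha> h)"
proof -
  define g where "g = (\<lambda>n. y (real n * h))"
  have step: "\<exists>x. ivp_value F (real (Suc n) * h) (real n * h) (g n) x \<and> norm (g (Suc n) - x) \<le> h * \<alpha> h"
    if "real (Suc n) * h \<le> T" for n
  proof -
    have "1 \<le> Suc n" by simp
    with approx that obtain x
      where "ivp_value F (real (Suc n) * h) (real (Suc n - 1) * h) (y (real (Suc n - 1) * h)) x"
      and gx: "g (Suc n) = x + (h * \<alpha> h) *\<^sub>R v (Suc n)"
      unfolding approximation_def g_def by blast
    then have x: "ivp_value F (real (Suc n) * h) (real n * h) (g n) x"
      unfolding g_def diff_Suc_1 by blast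
    have "h * \<alpha> h * norm (v (Suc n)) \<le> h * \<alpha> h * 1"
      using v h \<open>0 \<le> \<alpha> h\<close> by (intro mult_left_mono) (auto simp: perturbations_def)
    then show ?thesis
      using x gx h \<open>0 \<le> \<alpha> h\<close> by (auto simp: abs_mult)
  qed
  then have orbit: "perturbed_orbit h (\<alpha> h) T g"
    by (auto simp: perturbed_orbit_def)
  have "g 0 = 0"
    using approx by (simp add: approximation_def g_def)
  define n where "n = nat \<lfloor>T / h\<rfloor>"
  have n: "real n * h \<le> T" "T < real (Suc n) * h"
    using h \<open>0 \<le> T\<close> floor_divide_lower[of h T] floor_divide_upper[of h T]
    by (auto simp: n_def algebra_simps)
  have gn: "norm (g n) \<le> 2 * window_error * \<alpha> h"
    by (rule orbit_bound[OF orbit \<open>g 0 = 0\<close> h \<open>0 \<le> \<alpha> h\<close> small n(1)])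
  then have "norm (g n) \<le> K * (2 * window_error * \<alpha> h)"
    using K_ge_1 by (meson mult_le_cancel_right1 norm_ge_zero order_trans linorder_not_le)
  then have "norm (g n) < r" using small by simp
  \<comment> \<open>The last clause of \<open>approximation\<close> numbers an interval by its right
    end, hence is used at \<open>Suc n\<close>.\<close>
  moreover have "ivp_value F T (real n * h) (g n) (y T)"
    using approx n unfolding approximation_def g_def
    by (metis diff_Suc_1 le_add1 plus_1_eq_Suc order_refl)
  ultimately have "norm (y T) \<le> K * norm (g n)"
    using h by (intro ivp_value_bounded) auto
  also have "\<dots> \<le> K * (2 * window_error * \<alpha> h)"
    using gn K_ge_1 by (intro mult_left_mono) auto
  finally show ?thesis .
qed

text \<open>The orbit is defined by recursion before it is known to stay where solutions exist. As
  \<open>perturbed_orbit\<close> constrains steps inside the ball, \<open>orbit_bound\<close> shows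
  afterwards that all values used are genuine.\<close>

lemma approximation_exists:
  assumes v: "v \<in> perturbations" and h: "0 < h" "h \<le> 1"
    and "0 \<le> \<alpha> h" and small: "K * (2 * window_error * \<alpha> h) < r"
  shows "\<exists>y. approximation F \<alpha> h v T y"
proof -
  \<comment> \<open>An arbitrary value where no solution exists.\<close>
  define \<phi> where "\<phi> = (\<lambda>t s \<eta>. SOME x. ivp_value F t s \<eta> x)"
  have \<phi>: "ivp_value F t s \<eta> (\<phi> t s \<eta>)" if "norm \<eta> < r" "0 \<le> s" "s \<le> t" for t s \<eta>
    using decay[OF that] unfolding \<phi>_def by (metis someI_ex)
  have \<phi>_refl: "\<phi> s s \<eta> = \<eta>" if "norm \<eta> < r" "0 \<le> s" for s \<eta>
    using \<phi>[OF that order_refl] by (auto simp: ivp_value_def solves_ivp_def)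
  define g where "g = rec_nat 0 (\<lambda>n x. \<phi> (real (Suc n) * h) (real n * h) x + (h * \<alpha> h) *\<^sub>R v (Suc n))"
  have g_0: "g 0 = 0"
    and g_Suc: "g (Suc n) = \<phi> (real (Suc n) * h) (real n * h) (g n) + (h * \<alpha> h) *\<^sub>R v (Suc n)" for n
    by (simp_all add: g_def)
  have step_le: "real n * h \<le> real (Suc n) * h" for n
    using h by (intro mult_right_mono) auto
  have orbit: "perturbed_orbit h (\<alpha> h) T' g" for T'
    unfolding perturbed_orbit_def
  proof (intro allI impI exI conjI)
    fix n assume "norm (g n) < r"
    then show "ivp_value F (real (Suc n) * h) (real n * h) (g n) (\<phi> (real (Suc n) * h) (real n * h) (g n))"
      using h step_le by (intro \<phi>) auto
    have "h * \<alpha> h * norm (v (Suc n)) \<le> h * \<alpha> h * 1"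
      using v h \<open>0 \<le> \<alpha> h\<close> by (intro mult_left_mono) (auto simp: perturbations_def)
    then show "norm (g (Suc n) - \<phi> (real (Suc n) * h) (real n * h) (g n)) \<le> h * \<alpha> h"
      using h \<open>0 \<le> \<alpha> h\<close> by (simp add: g_Suc abs_mult del: of_nat_Suc)
  qed
  have gn: "norm (g n) < r" for n
  proof -
    have "norm (g n) \<le> 2 * window_error * \<alpha> h"
      \<comment> \<open>The final time is taken to be \<open>real n * h\<close>, so the bound holds
        for every \<open>n\<close>.\<close>
      by (rule orbit_bound[OF orbit g_0 h \<open>0 \<le> \<alpha> h\<close> small order_refl])
    then have "norm (g n) \<le> K * (2 * window_error * \<alpha> h)"
      using K_ge_1 by (meson mult_le_cancel_right1 norm_ge_zero order_trans linorder_not_le)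
    then show ?thesis using small by simp
  qed
  \<comment> \<open>The floor picks the interval closed on the left, so at a grid point the piece to
    its right applies and returns \<open>g n\<close>, the value after the jump.\<close>
  define y where "y = (\<lambda>t. let n = nat \<lfloor>t / h\<rfloor> in \<phi> t (real n * h) (g n))"
  have y_piece: "y t = \<phi> t (real n * h) (g n)" if "real n * h \<le> t" "t < real (Suc n) * h" for n t
  proof -
    have "\<lfloor>t / h\<rfloor> = int n"
      using that h by (intro floor_unique) (auto simp: field_simps)
    then show ?thesis by (simp add: y_def)
  qed
  have y_grid: "y (real n * h) = g n" for n
    using y_piece[of n "real n * h"] \<phi>_refl[OF gn] h by simp
  have "approximation F \<alpha> h v T y"
    unfolding approximation_def
  proof (intro conjI allI impI)
    show "y 0 = 0" using y_grid[of 0] g_0 by simp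
  next
    fix n :: nat assume "1 \<le> n"
    then obtain m where "n = Suc m" by (cases n) auto
    then show "\<exists>x. ivp_value F (real n * h) (real (n - 1) * h) (y (real (n - 1) * h)) x
        \<and> y (real n * h) = x + (h * \<alpha> h) *\<^sub>R v n"
      using \<phi>[OF gn _ step_le] h by (auto simp: y_grid g_Suc simp del: of_nat_Suc)
  next
    fix n :: nat and t assume "1 \<le> n" and t: "real (n - 1) * h \<le> t" "t < real n * h"
    then obtain m where "n = Suc m" by (cases n) auto
    then show "ivp_value F t (real (n - 1) * h) (y (real (n - 1) * h)) (y t)"
      using \<phi>[OF gn _ t(1)] y_piece[of m t] t h by (simp add: y_grid del: of_nat_Suc)
  qed
  then show ?thesis by blast
qed

section \<open>The upper limit\<close>

lemma max_error_bound:
  assumes "0 < h" "h \<le> 1" "0 \<le> \<alpha> h" "K * (2 * window_error * \<alpha> h) < r" "0 \<le> t"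
  shows "max_error F \<alpha> t h \<le> ereal (K * (2 * window_error * \<alpha> h))"
  using approximation_exists[of _ h \<alpha> t] approximation_bound[of \<alpha> h _ t] assms
  by (auto simp: max_error_def approximations_def intro!: SUP_least)

text \<open>The bound on \<open>max_error\<close> is linear in \<open>\<alpha> h\<close>, so
  division leaves a constant free of \<open>\<alpha>\<close> and \<open>t\<close>; the smallness
  condition holds eventually because \<open>\<alpha>\<close> tends to 0.\<close>

lemma E_fun_bound:
  assumes \<alpha>: "gauge_fun \<alpha>" and "0 \<le> t"
  shows "E_fun F \<alpha> t \<le> ereal (2 * K * window_error)"
  unfolding E_fun_def
proof (rule Limsup_bounded)
  have \<alpha>_pos: "0 < \<alpha> h" if "0 < h" for h
    using \<alpha> that strict_mono_onD[of "{0..}" \<alpha> 0 h] by (auto simp: gauge_fun_def)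
  have "(\<alpha> \<longlongrightarrow> \<alpha> 0) (at 0 within {0..})"
    using \<alpha> unfolding gauge_fun_def continuous_on_def by fastforce
  then have "(\<alpha> \<longlongrightarrow> 0) (at_right 0)"
    using \<alpha> by (auto simp: gauge_fun_def intro: tendsto_within_subset)
  then have "((\<lambda>h. K * (2 * window_error * \<alpha> h)) \<longlongrightarrow> K * (2 * window_error * 0)) (at_right 0)"
    by (intro tendsto_intros)
  then have "\<forall>\<^sub>F h in at_right 0. K * (2 * window_error * \<alpha> h) < r"
    using r_pos by (intro order_tendstoD(2)) auto
  moreover have "\<forall>\<^sub>F h in at_right 0. h \<in> {0<..<1::real}"
    by (rule eventually_at_right_real) simp
  ultimately show "\<forall>\<^sub>F h in at_right 0. max_error F \<alpha> t h / ereal (\<alpha> h) \<le> ereal (2 * K * window_error)"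
  proof eventually_elim
    case (elim h)
    then have "max_error F \<alpha> t h \<le> ereal (K * (2 * window_error * \<alpha> h))"
      using \<alpha>_pos[of h] \<open>0 \<le> t\<close> by (intro max_error_bound) auto
    then show ?case
      using \<alpha>_pos[of h] elim by (subst ereal_divide_le_pos) (auto simp: mult_ac)
  qed
qed

end

theorem theorem6p5:
  fixes F :: "real \<Rightarrow> real ^ 'd \<Rightarrow> real ^ 'd"
  assumes cont_t: "\<And>y. continuous_on {0..} (\<lambda>t. F t y)"
    and loc_lip: "local_lipschitz {0..} UNIV F"
    and zero: "\<And>t. t \<ge> 0 \<Longrightarrow> F t 0 = 0"
    and unif_lip: "\<exists>L>0. \<exists>r0>0. \<forall>t\<ge>0. \<forall>y1 y2. norm y1 < r0 \<longrightarrow> norm y2 < r0 \<longrightarrow>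
                     norm (F t y1 - F t y2) \<le> L * norm (y1 - y2)"
    and stable: "exponentially_stable F"
  shows "\<exists>C::real. \<forall>\<alpha>. gauge_fun \<alpha> \<longrightarrow> (\<forall>t\<ge>0. E_fun F \<alpha> t \<le> ereal C)"
proof -
  obtain L r0 where L: "L > 0" "r0 > 0" and lip: "\<And>t y1 y2. t \<ge> 0 \<Longrightarrow> norm y1 < r0 \<Longrightarrow> norm y2 < r0 \<Longrightarrow>
                     norm (F t y1 - F t y2) \<le> L * norm (y1 - y2)"
    using unif_lip by blast
  obtain r c K where rcK: "r > 0" "c > 0" "K > 0"
    and decay: "\<And>y0 t0 t. norm y0 < r \<Longrightarrow> 0 \<le> t0 \<Longrightarrow> t0 \<le> t \<Longrightarrow>
        \<exists>x. ivp_value F t t0 y0 x \<and> norm x \<le> K * exp (- c * (t - t0)) * norm y0"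
    using stable unfolding exponentially_stable_def by blast
  \<comment> \<open>The smaller radius makes the Lipschitz and decay hypotheses available together;
    raising \<open>K\<close> to at least 1 only weakens the decay estimate.\<close>
  interpret stable_ivp F L "min r r0" c "max K 1"
  proof
    fix y :: "real ^ 'd" and s t :: real
    assume "norm y < min r r0" "0 \<le> s" "s \<le> t"
    then obtain x where x: "ivp_value F t s y x" "norm x \<le> K * exp (- c * (t - s)) * norm y"
      using decay[of y s t] by auto
    have "K * exp (- c * (t - s)) * norm y \<le> max K 1 * exp (- c * (t - s)) * norm y"
      by (intro mult_right_mono) auto
    with x show "\<exists>x. ivp_value F t s y x \<and> norm x \<le> max K 1 * exp (- c * (t - s)) * norm y"
      using order_trans by blast
  qed (use cont_t loc_lip lip L rcK in auto)
  show ?thesis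
    \<comment> \<open>The witness \<open>2 * max K 1 * window_error\<close> depends only on
      \<open>L\<close>, \<open>c\<close> and \<open>K\<close>, so it can be fixed before
      \<open>\<alpha>\<close> and \<open>t\<close>.\<close>
    using E_fun_bound by blast
qed

end
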